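(* Let $\mathcal P_1$ be a set of $m$ points on a line $\ell$ in $\mathbb R^2$ and let $\mathcal P_2$ be a set of $n$ points in $\mathbb R^2$. Then \[ D(\mathcal P_1,\mathcal P_2) = \begin{cases} \Omega(m^{1/2}n^{1/2} \log^{-1/2}n), & \text{when } m=\Omega(n^{1/2}/\log^{1/3} n),\\ \Omega\left(n^{3/8}m^{3/4}\right), & \text{when } m=O(n^{1/2}/\log^{1/3} n) \text{ and } m=\Omega(n^{3/10}),\\ \Omega\left(n^{1/2}m^{1/3}\right), & \text{when } m=O(n^{3/10}). \end{cases} \]
   Context: For finite sets $\mathcal P_1,\mathcal P_2\subset\mathbb R^2$, $D(\mathcal P_1,\mathcal P_2)$ denotes the number of distinct distances $|ab|>0$ with $a\in\mathcal P_1$, $b\in\mathcal P_2$, where $|ab|$ is the Euclidean distance. The asymptotic conditions on $m$ and the bounds are to be understood with respect to fixed (absolute) constants: each case asserts that for any fixed constants in the hypothesis on $m$, the corresponding lower bound holds with some absolute implicit constant.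
   Formalization: n ≥ 2 is assumed throughout (log n must be positive), and m ≥ 2 in the third case, which is false for m = 1: if the n points lie on a circle centred at the single point on the line, there is only one distance. *)

theory Defs
  imports "HOL-Analysis.Analysis"
begin

definition num_dist :: "(real^2) set \<Rightarrow> (real^2) set \<Rightarrow> nat" where
  "num_dist P1 P2 = card {dist a b | a b. a \<in> P1 \<and> b \<in> P2 \<and> dist a b > 0}"

definition is_line :: "(real^2) set \<Rightarrow> bool" where
  "is_line l \<longleftrightarrow> affine l \<and> aff_dim l = 1"

definition line_config :: "nat \<Rightarrow> nat \<Rightarrow> (real^2) set \<Rightarrow> (real^2) set \<Rightarrow> (real^2) set \<Rightarrow> bool" where
  "line_config m n l P1 P2 \<longleftrightarrow>
     is_line l \<and>
     finite P1 \<and> card P1 = m \<and> P1 \<subseteq> l \<and>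
     finite P2 \<and> card P2 = n"

(* The size restrictions are kept outside line_config. The bounds involve log n and are taken for
   n at least 2. The bound n^(1/2) m^(1/3) for small m needs m at least 2: with P1 = {p} and P2 on
   a circle about p there is only one distance, however large n is. *)

end

theory Submission
  imports Defs
begin

text \<open>
  The map \<open>b \<mapsto> (b \<bullet> u, \<parallel>b\<parallel>\<^sup>2)\<close> sends circles centred on the line \<open>\<real> u\<close> to straight lines
  and identifies only mirror images. So \<open>D\<close> distances give at least \<open>n/2\<close> points, each on \<open>m\<close> of
  about \<open>m D\<close> lines, and the Szemeredi--Trotter theorem yields \<open>D \<ge> c (m n)\<^sup>1\<^sup>/\<^sup>2\<close> for
  \<open>2 \<le> m \<le> n\<close>; for \<open>m \<ge> n\<close> the distances from a single point suffice. This dominates each of the three bounds; for \<open>m = 1\<close> the hypotheses bound \<open>n\<close>.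
  Szemeredi--Trotter follows from the crossing lemma by Szekely's argument, and the bound
  \<open>E \<le> 3 V\<close> for crossing-free straight-line drawings from a charging argument: every edge is
  topmost at its left endpoint, topmost at its right endpoint, or the first edge vertically below
  some vertex.
\<close>

section \<open>Straight-line drawings\<close>

type_synonym point = "real \<times> real"
type_synonym edge = "point \<times> point"

abbreviation xl :: "edge \<Rightarrow> real" where "xl e \<equiv> fst (fst e)"
abbreviation xr :: "edge \<Rightarrow> real" where "xr e \<equiv> fst (snd e)"

definition slope :: "edge \<Rightarrow> real" where
  "slope e = (snd (snd e) - snd (fst e)) / (xr e - xl e)"

definition height :: "edge \<Rightarrow> real \<Rightarrow> real" where
  "height e x = snd (fst e) + slope e * (x - xl e)"

text \<open>Only common points interior to both edges count: edges sharing an end point do not cross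
  there, whereas a collinear overlap is a crossing.\<close>

definition crosses :: "edge \<Rightarrow> edge \<Rightarrow> bool" where
  "crosses e f \<longleftrightarrow> e \<noteq> f \<and>
     (\<exists>x. xl e < x \<and> x < xr e \<and> xl f < x \<and> x < xr f \<and> height e x = height f x)"

text \<open>Edges run from left to right, so none is vertical and each is the graph of its
  \<open>height\<close>. Crossings are allowed; the last clause keeps vertices out of the interiors
  of edges.\<close>

definition drawing :: "point set \<Rightarrow> edge set \<Rightarrow> bool" where
  "drawing V E \<longleftrightarrow> finite V \<and> E \<subseteq> V \<times> V \<and> (\<forall>e\<in>E. xl e < xr e) \<and>
     (\<forall>e\<in>E. \<forall>r\<in>V. xl e < fst r \<and> fst r < xr e \<longrightarrow> snd r \<noteq> height e (fst r))"

lemma height_left [simp]: "height e (xl e) = snd (fst e)"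
  by (simp add: height_def)

lemma height_right: "xl e < xr e \<Longrightarrow> height e (xr e) = snd (snd e)"
  by (simp add: height_def slope_def)

lemma height_eq: "height e x = height e y + slope e * (x - y)"
  by (simp add: height_def algebra_simps)

lemma height_sign_change:
  assumes "height e a < height f a" "height f b < height e b"
  obtains x where "min a b < x" "x < max a b" "height e x = height f x"
proof -
  have "\<exists>x. min a b \<le> x \<and> x \<le> max a b \<and> height e x - height f x = 0"
  proof (cases "a \<le> b")
    case True
    have "\<exists>x. a \<le> x \<and> x \<le> b \<and> height e x - height f x = 0"
      by (rule IVT') (use assms True in \<open>auto simp: height_def intro!: continuous_intros\<close>)
    with True show ?thesis by auto
  next
    case False
    have "\<exists>x. b \<le> x \<and> x \<le> a \<and> height e x - height f x = 0"
      by (rule IVT2') (use assms False in \<open>auto simp: height_def intro!: continuous_intros\<close>)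
    with False show ?thesis by auto
  qed
  then obtain x where x: "min a b \<le> x" "x \<le> max a b" "height e x = height f x" by auto
  moreover have "x \<noteq> a" "x \<noteq> b" using assms x(3) by auto
  ultimately show ?thesis by (intro that[of x]) (auto simp: min_def max_def split: if_splits)
qed

lemma drawing_finite: "drawing V E \<Longrightarrow> finite E"
  unfolding drawing_def by (meson finite_SigmaI finite_subset)

lemma drawing_subset: "drawing V E \<Longrightarrow> F \<subseteq> E \<Longrightarrow> drawing V F"
  unfolding drawing_def by blast

lemma drawing_restrict:
  assumes "drawing V E" "S \<subseteq> V"
  shows "drawing S {e \<in> E. fst e \<in> S \<and> snd e \<in> S}"
  unfolding drawing_def
proof (intro conjI ballI impI)
  show "finite S" using assms by (auto simp: drawing_def intro: finite_subset)
  fix e assume e: "e \<in> {e \<in> E. fst e \<in> S \<and> snd e \<in> S}"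
  then show "xl e < xr e" using assms(1) by (simp add: drawing_def)
  fix r assume "r \<in> S" "xl e < fst r \<and> fst r < xr e"
  then show "snd r \<noteq> height e (fst r)" using assms e by (simp add: drawing_def subset_eq del: split_paired_All)
qed auto

section \<open>Crossing-free drawings: a linear bound on the number of edges\<close>

locale plane_drawing =
  fixes V :: "point set" and E :: "edge set"
  assumes drawing: "drawing V E"
  assumes no_cross: "\<And>e f. e \<in> E \<Longrightarrow> f \<in> E \<Longrightarrow> \<not> crosses e f"
begin

lemma lr: "e \<in> E \<Longrightarrow> xl e < xr e"
  using drawing by (auto simp: drawing_def)

lemma ends: "e \<in> E \<Longrightarrow> fst e \<in> V" "e \<in> E \<Longrightarrow> snd e \<in> V"
  using drawing by (auto simp: drawing_def)

lemma avoid: "e \<in> E \<Longrightarrow> r \<in> V \<Longrightarrow> xl e < fst r \<Longrightarrow> fst r < xr e \<Longrightarrow> snd r \<noteq> height e (fst r)"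
  using drawing by (auto simp: drawing_def)

lemma edge_eqI:
  assumes "e \<in> E" "f \<in> E" "xl e < x" "x < xr e" "xl f < x" "x < xr f" "height e x = height f x"
  shows "e = f"
  using no_cross[OF assms(1,2)] assms(3-) by (auto simp: crosses_def)

text \<open>A change of order would give a common point strictly between \<open>a\<close> and
  \<open>b\<close>, interior to both edges. Equality at \<open>b\<close> remains possible because
  the edges may meet there in an end point.\<close>

lemma same_order:
  assumes "e \<in> E" "f \<in> E" "height e a < height f a"
    and "xl e \<le> a" "a \<le> xr e" "xl f \<le> a" "a \<le> xr f"
    and "xl e \<le> b" "b \<le> xr e" "xl f \<le> b" "b \<le> xr f"
  shows "height e b \<le> height f b"
proof (rule ccontr)
  assume "\<not> height e b \<le> height f b"
  then obtain x where "min a b < x" "x < max a b" "height e x = height f x"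
    using height_sign_change[OF assms(3), of b] by auto
  with assms have "e = f"
    by (intro edge_eqI[of e f x]) (auto simp: min_def max_def split: if_splits)
  with assms(3) show False by simp
qed

text \<open>To the left of a common right end point the edge of smaller slope lies higher; at a left
  end point it is the edge of larger slope.\<close>

definition top_at_right :: "edge set" where
  "top_at_right = {e \<in> E. \<forall>g\<in>E. snd g = snd e \<longrightarrow> slope e \<le> slope g}"

definition top_at_left :: "edge set" where
  "top_at_left = {e \<in> E. \<forall>g\<in>E. fst g = fst e \<longrightarrow> slope g \<le> slope e}"

text \<open>Vertical ray shooting: among the edges whose interior spans the abscissa of
  \<open>w\<close>, none lies strictly between \<open>e\<close> and \<open>w\<close>.\<close>

definition first_below :: "edge \<Rightarrow> point \<Rightarrow> bool" where
  "first_below e w \<longleftrightarrow> w \<in> V \<and> xl e < fst w \<and> fst w < xr e \<and> height e (fst w) < snd w \<and>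
     (\<forall>g\<in>E. xl g < fst w \<and> fst w < xr g \<and> height g (fst w) < snd w
        \<longrightarrow> height g (fst w) \<le> height e (fst w))"

lemma first_below_vertex: "first_below e w \<Longrightarrow> w \<in> V"
  by (simp add: first_below_def)

text \<open>Two such edges with the same right end point have equal slope, so they overlap just left
  of it and coincide. Hence the end point determines the edge.\<close>

lemma card_top_at_right: "card top_at_right \<le> card V"
proof (rule card_inj_on_le[of snd])
  show "inj_on snd top_at_right"
  proof (rule inj_onI)
    fix e f assume e: "e \<in> top_at_right" and f: "f \<in> top_at_right" and ef: "snd e = snd f"
    then have *: "e \<in> E" "f \<in> E" "slope e = slope f" by (auto simp: top_at_right_def intro: antisym)
    obtain x where x: "max (xl e) (xl f) < x" "x < xr e"
      using lr[OF *(1)] lr[OF *(2)] ef dense[of "max (xl e) (xl f)" "xr e"] by auto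
    have "height e x = height f x"
      using height_eq[of e x "xr e"] height_eq[of f x "xr f"] *(3) ef
        height_right[OF lr[OF *(1)]] height_right[OF lr[OF *(2)]] by simp
    then show "e = f" using x ef by (intro edge_eqI[OF *(1,2), of x]) auto
  qed
qed (use ends drawing in \<open>auto simp: top_at_right_def drawing_def\<close>)

lemma card_top_at_left: "card top_at_left \<le> card V"
proof (rule card_inj_on_le[of fst])
  show "inj_on fst top_at_left"
  proof (rule inj_onI)
    fix e f assume e: "e \<in> top_at_left" and f: "f \<in> top_at_left" and ef: "fst e = fst f"
    then have *: "e \<in> E" "f \<in> E" "slope e = slope f" by (auto simp: top_at_left_def intro: antisym)
    obtain x where x: "x < min (xr e) (xr f)" "xl e < x"
      using lr[OF *(1)] lr[OF *(2)] ef dense[of "xl e" "min (xr e) (xr f)"] by auto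
    have "height e x = height f x" using *(3) ef by (simp add: height_def)
    then show "e = f" using x ef by (intro edge_eqI[OF *(1,2), of x]) auto
  qed
qed (use ends drawing in \<open>auto simp: top_at_left_def drawing_def\<close>)

text \<open>Two edges that are both first below the same \<open>w\<close> have equal height there,
  at an interior point of both, so they coincide. Any choice of \<open>w\<close> is therefore
  injective.\<close>

lemma card_first_below: "card {e \<in> E. \<exists>w. first_below e w} \<le> card V"
proof (rule card_inj_on_le[of "\<lambda>e. SOME w. first_below e w"])
  have some: "first_below e (SOME w. first_below e w)" if "\<exists>w. first_below e w" for e
    using that by (rule someI_ex)
  show "inj_on (\<lambda>e. SOME w. first_below e w) {e \<in> E. \<exists>w. first_below e w}"
  proof (rule inj_onI)
    fix e f assume e: "e \<in> {e \<in> E. \<exists>w. first_below e w}" and f: "f \<in> {e \<in> E. \<exists>w. first_below e w}"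
      and eq: "(SOME w. first_below e w) = (SOME w. first_below f w)"
    obtain w where "first_below e w" "first_below f w"
      using some[of e] some[of f] e f eq by (metis (mono_tags, lifting) mem_Collect_eq)
    then show "e = f" using e f
      by (intro edge_eqI[of e f "fst w"]) (auto simp: first_below_def intro!: antisym)
  qed
  show "(\<lambda>e. SOME w. first_below e w) ` {e \<in> E. \<exists>w. first_below e w} \<subseteq> V"
    using some first_below_vertex by blast
qed (use drawing in \<open>auto simp: drawing_def\<close>)

text \<open>Let \<open>f\<close> be the edge following \<open>e\<close> counterclockwise around the left endpoint of \<open>e\<close>. If the
  wedge between \<open>e\<close> and \<open>f\<close> contains a vertex, the leftmost one sees \<open>e\<close> vertically below it; if
  not, \<open>f\<close> shields the right endpoint of \<open>e\<close> from above.\<close>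

lemma edge_cases:
  assumes e: "e \<in> E"
  shows "e \<in> top_at_right \<or> e \<in> top_at_left \<or> (\<exists>w. first_below e w)"
proof (rule ccontr)
  assume contra: "\<not> ?thesis"
  define F where "F = {f \<in> E. fst f = fst e \<and> slope e < slope f}"
  have "e \<notin> top_at_left" using contra by simp
  with e have "\<exists>g\<in>E. fst g = fst e \<and> slope e < slope g" by (simp add: top_at_left_def not_le)
  then have "F \<noteq> {}" unfolding F_def by blast
  moreover have "finite F" using drawing_finite[OF drawing] by (simp add: F_def)
  ultimately obtain f where fF: "f \<in> F" and fmin: "\<And>g. g \<in> F \<Longrightarrow> slope f \<le> slope g"
    using arg_min_if_finite[of F slope] by (metis not_le)
  have f: "f \<in> E" and fe: "fst f = fst e" and sl: "slope e < slope f"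
    using fF by (auto simp: F_def)
  have ef: "height e x < height f x" if "xl e < x" for x
    using that sl fe by (simp add: height_def)
  \<comment> \<open>The vertices of the wedge, with \<open>e\<close> excluded but \<open>f\<close>
    and its right end point included: if \<open>f\<close> ends before \<open>e\<close>, that end
    point has to count.\<close>
  define R where "R = {w \<in> V. xl e < fst w \<and> fst w < xr e \<and> fst w \<le> xr f \<and>
    height e (fst w) < snd w \<and> snd w \<le> height f (fst w)}"
  have finR: "finite R" using drawing by (simp add: R_def drawing_def)
  show False
  proof (cases "R = {}")
    case False
    obtain w where wR: "w \<in> R" and wmin: "\<And>z. z \<in> R \<Longrightarrow> fst w \<le> fst z"
      using arg_min_if_finite[OF finR False, of fst] by (metis not_le)
    have w: "w \<in> V" "xl e < fst w" "fst w < xr e" "fst w \<le> xr f"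
      "height e (fst w) < snd w" "snd w \<le> height f (fst w)"
      using wR by (auto simp: R_def)
    have "first_below e w" unfolding first_below_def
    proof (intro conjI ballI impI w)
      fix g assume g: "g \<in> E" and "xl g < fst w \<and> fst w < xr g \<and> height g (fst w) < snd w"
      then have gw: "xl g < fst w" "fst w < xr g" "height g (fst w) < snd w" by auto
      show "height g (fst w) \<le> height e (fst w)"
      proof (rule ccontr)
        assume "\<not> ?thesis"
        then have eg: "height e (fst w) < height g (fst w)" by simp
        have gf: "height g (fst w) < height f (fst w)" using gw w by linarith
        \<comment> \<open>An edge \<open>g\<close> between \<open>e\<close> and \<open>w\<close> is
          trapped in the wedge. Either it starts there, at a vertex of \<open>R\<close> further left
          than \<open>w\<close>, or it reaches back to the apex, must start there, and has a slope
          between those of \<open>e\<close> and \<open>f\<close>, against the choice of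
          \<open>f\<close>.\<close>
        show False
        proof (cases "xl e < xl g")
          case True
          have "height e (xl g) \<le> height g (xl g)"
            by (rule same_order[OF e g eg]) (use w gw True in auto)
          moreover have "height e (xl g) \<noteq> snd (fst g)"
            using avoid[OF e ends(1)[OF g]] True gw w by force
          moreover have "height g (xl g) \<le> height f (xl g)"
            by (rule same_order[OF g f gf]) (use w gw True fe in auto)
          ultimately have "fst g \<in> R" using True gw w ends(1)[OF g] by (auto simp: R_def)
          with wmin gw show False by fastforce
        next
          case False
          have "height e (xl e) \<le> height g (xl e)"
            by (rule same_order[OF e g eg]) (use w gw False in auto)
          moreover have "height g (xl e) \<le> height f (xl e)"
            by (rule same_order[OF g f gf]) (use w gw False fe in auto)
          moreover have "height f (xl e) = snd (fst e)" using fe height_left[of f] by simp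
          ultimately have eq: "height g (xl e) = snd (fst e)" by simp
          have "xl g = xl e" using avoid[OF g ends(1)[OF e]] eq False gw w by force
          with eq have ge: "fst g = fst e" using height_left[of g] by (simp add: prod_eq_iff)
          have "slope e < slope g" "slope g < slope f"
            using eg gf w ge fe by (auto simp: height_def)
          with fmin[of g] g ge show False by (simp add: F_def)
        qed
      qed
    qed
    with contra show False by blast
  next
    case True
    have rf: "xr e \<le> xr f"
    proof (rule ccontr)
      assume "\<not> ?thesis"
      then have "snd f \<in> R"
        using ef[of "xr f"] lr[OF f] fe ends(2)[OF f] height_right[OF lr[OF f]] by (auto simp: R_def)
      with True show False by simp
    qed
    have "e \<notin> top_at_right" using contra by simp
    with e have "\<exists>g\<in>E. snd g = snd e \<and> slope g < slope e" by (simp add: top_at_right_def not_le)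
    then obtain g where g: "g \<in> E" "snd g = snd e" "slope g < slope e" by blast
    have hr: "height g (xr e) = height e (xr e)"
      using height_right[OF lr[OF e]] height_right[OF lr[OF g(1)]] g(2) by simp
    have eg: "height e x < height g x" if "x < xr e" for x
    proof -
      have "slope e * (x - xr e) < slope g * (x - xr e)"
        using that g(3) by (intro mult_strict_right_mono_neg) auto
      then show ?thesis using height_eq[of e x "xr e"] height_eq[of g x "xr e"] hr by simp
    qed
    have gf: "height g (xr e) < height f (xr e)" using hr ef[OF lr[OF e]] by simp
    \<comment> \<open>Now \<open>g\<close> arrives at the right end point of \<open>e\<close> from
      above \<open>e\<close> and below \<open>f\<close>. It either starts inside the empty wedge or
      would be strictly above the apex and at most as high as it.\<close>
    show False
    proof (cases "xl e < xl g")
      case True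
      have "height g (xl g) \<le> height f (xl g)"
        by (rule same_order[OF g(1) f gf]) (use lr[OF e] lr[OF g(1)] g(2) rf True fe in auto)
      then have "fst g \<in> R"
        using True eg[of "xl g"] lr[OF g(1)] g(2) rf ends(1)[OF g(1)] by (auto simp: R_def)
      with \<open>R = {}\<close> show False by simp
    next
      case False
      have "height g (xl e) \<le> height f (xl e)"
        by (rule same_order[OF g(1) f gf]) (use lr[OF e] lr[OF g(1)] g(2) rf False fe in auto)
      moreover have "height f (xl e) = height e (xl e)" using fe height_left[of f] by simp
      ultimately show False using eg[OF lr[OF e]] by simp
    qed
  qed
qed

lemma card_edges_le: "card E \<le> 3 * card V"
proof -
  let ?B = "{e \<in> E. \<exists>w. first_below e w}"
  have fin: "finite E" using drawing_finite[OF drawing] .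
  have "E \<subseteq> top_at_right \<union> top_at_left \<union> ?B" using edge_cases by blast
  moreover have "finite (top_at_right \<union> top_at_left \<union> ?B)"
    using fin by (auto simp: top_at_right_def top_at_left_def)
  ultimately have "card E \<le> card (top_at_right \<union> top_at_left \<union> ?B)" by (rule card_mono[rotated])
  also have "\<dots> \<le> card top_at_right + card top_at_left + card ?B"
    by (meson add_right_mono card_Un_le le_trans)
  finally show ?thesis using card_top_at_right card_top_at_left card_first_below by linarith
qed

end

section \<open>The crossing lemma\<close>

text \<open>The pairs are ordered, so each crossing is counted twice; this affects constants
  only.\<close>

definition crossing_pairs :: "edge set \<Rightarrow> (edge \<times> edge) set" where
  "crossing_pairs E = {(e, f) \<in> E \<times> E. crosses e f}"

lemma finite_crossing_pairs: "finite E \<Longrightarrow> finite (crossing_pairs E)"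
  unfolding crossing_pairs_def by (rule finite_subset[of _ "E \<times> E"]) auto

text \<open>Deleting the first edge of every crossing pair leaves a crossing-free drawing and
  removes at most one edge per pair.\<close>

lemma card_edges_le_crossing:
  assumes "drawing V E"
  shows "card E \<le> 3 * card V + card (crossing_pairs E)"
proof -
  let ?F = "fst ` crossing_pairs E"
  have fin: "finite E" using drawing_finite[OF assms] .
  interpret plane_drawing V "E - ?F"
  proof
    show "drawing V (E - ?F)" using drawing_subset[OF assms] by blast
    show "\<not> crosses e f" if "e \<in> E - ?F" "f \<in> E - ?F" for e f
    proof
      assume "crosses e f"
      with that have "(e, f) \<in> crossing_pairs E" by (simp add: crossing_pairs_def)
      with that show False by (metis DiffE fst_conv imageI)
    qed
  qed
  have "card E \<le> card (E - ?F) + card ?F"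
    using fin by (metis card_Un_le Un_Diff_cancel2 card_mono finite_UnI finite_Diff Un_upper1
        finite_crossing_pairs finite_imageI le_trans)
  also have "card ?F \<le> card (crossing_pairs E)"
    by (rule card_image_le[OF finite_crossing_pairs[OF fin]])
  finally show ?thesis using card_edges_le by linarith
qed

text \<open>A shared left or right end point would be a second common point, so both edges would lie
  on one line; as no vertex is interior to an edge, they would be equal. This gives a crossing
  survival probability \<open>p ^ 4\<close> under sampling.\<close>

lemma crosses_distinct_ends:
  assumes "drawing V E" "e \<in> E" "f \<in> E" "crosses e f"
  shows "card {fst e, snd e, fst f, snd f} = 4"
proof -
  obtain x where x: "xl e < x" "x < xr e" "xl f < x" "x < xr f" "height e x = height f x"
    and ne: "e \<noteq> f" using assms(4) by (auto simp: crosses_def)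
  have av: "\<And>e r. e \<in> E \<Longrightarrow> r \<in> V \<Longrightarrow> xl e < fst r \<Longrightarrow> fst r < xr e \<Longrightarrow> snd r \<noteq> height e (fst r)"
    and V: "fst e \<in> V" "snd e \<in> V" "fst f \<in> V" "snd f \<in> V"
    and lr: "xl e < xr e" "xl f < xr f"
    using assms(1-3) by (auto simp: drawing_def)
  have same: "slope e = slope f" if "height e y = height f y" "y \<noteq> x" for y
  proof -
    have "slope e * (y - x) = slope f * (y - x)"
      using that(1) x(5) height_eq[of e y x] height_eq[of f y x] by simp
    with that(2) show ?thesis by simp
  qed
  have heq: "height e y = height f y" if "slope e = slope f" for y
    using that x(5) height_eq[of e y x] height_eq[of f y x] by simp
  have 1: "fst e \<noteq> fst f"
  proof
    assume eq: "fst e = fst f"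
    then have "slope e = slope f" using x by (intro same[of "xl e"]) (auto simp: height_def)
    note h = heq[OF this]
    have "\<not> xr e < xr f" using av[OF assms(3) V(2)] lr eq h height_right[OF lr(1)] by auto
    moreover have "\<not> xr f < xr e" using av[OF assms(2) V(4)] lr eq h height_right[OF lr(2)] by auto
    ultimately have "xr e = xr f" by simp
    then have "snd e = snd f"
      using h height_right[OF lr(1)] height_right[OF lr(2)] by (simp add: prod_eq_iff)
    with eq ne show False by (simp add: prod_eq_iff)
  qed
  have 2: "snd e \<noteq> snd f"
  proof
    assume eq: "snd e = snd f"
    then have "slope e = slope f"
      using x height_right[OF lr(1)] height_right[OF lr(2)] by (intro same[of "xr e"]) auto
    note h = heq[OF this]
    have "\<not> xl f < xl e" using av[OF assms(3) V(1)] lr eq h by (metis height_left)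
    moreover have "\<not> xl e < xl f" using av[OF assms(2) V(3)] lr eq h by (metis height_left)
    ultimately have "xl e = xl f" by simp
    then have "fst e = fst f" using h by (metis height_left prod_eq_iff)
    with eq ne show False by (simp add: prod_eq_iff)
  qed
  have 3: "fst e \<noteq> snd f" "snd e \<noteq> fst f" "fst e \<noteq> snd e" "fst f \<noteq> snd f"
    using x by auto
  show ?thesis using 1 2 3 by auto
qed

text \<open>\<open>sample_weight p V S\<close> is the probability that \<open>S\<close> is the outcome of keeping each element of
  \<open>V\<close> independently with probability \<open>p\<close>.\<close>

definition sample_weight :: "real \<Rightarrow> 'a set \<Rightarrow> 'a set \<Rightarrow> real" where
  "sample_weight p V S = p ^ card S * (1 - p) ^ card (V - S)"

text \<open>The sum is the expansion of the product of \<open>p + ?g x\<close> over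
  \<open>V\<close>: since \<open>?g\<close> vanishes on \<open>T\<close>, outcomes that lose an
  element of \<open>T\<close> contribute nothing.\<close>

lemma sum_sample_weight_superset:
  assumes "finite V" "T \<subseteq> V"
  shows "(\<Sum>S\<in>Pow V. sample_weight p V S * of_bool (T \<subseteq> S)) = p ^ card T"
proof -
  let ?g = "\<lambda>x. if x \<in> T then 0 else 1 - p"
  have "(\<Sum>S\<in>Pow V. sample_weight p V S * of_bool (T \<subseteq> S)) =
      (\<Sum>S\<in>Pow V. (\<Prod>x\<in>S. p) * (\<Prod>x\<in>V - S. ?g x))"
  proof (rule sum.cong[OF refl])
    fix S assume "S \<in> Pow V"
    have "(\<Prod>x\<in>V - S. ?g x) = (1 - p) ^ card (V - S) * of_bool (T \<subseteq> S)"
    proof (cases "T \<subseteq> S")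
      case True
      then have "(\<Prod>x\<in>V - S. ?g x) = (\<Prod>x\<in>V - S. 1 - p)" by (intro prod.cong) auto
      with True show ?thesis by simp
    next
      case False
      then have "\<exists>x\<in>V - S. ?g x = 0" using assms by auto
      with False assms show ?thesis by (simp add: prod_zero)
    qed
    then show "sample_weight p V S * of_bool (T \<subseteq> S) = (\<Prod>x\<in>S. p) * (\<Prod>x\<in>V - S. ?g x)"
      by (simp add: sample_weight_def)
  qed
  also have "\<dots> = (\<Prod>x\<in>V. p + ?g x)" by (rule prod_add[symmetric, OF assms(1)])
  also have "\<dots> = (\<Prod>x\<in>V. if x \<in> T then p else 1)" by (intro prod.cong) auto
  also have "\<dots> = p ^ card T"
    using assms by (simp add: prod.If_cases Int_absorb1)
  finally show ?thesis .
qed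

text \<open>Linearity of expectation for the number of surviving configurations
  \<open>T a\<close>.\<close>

lemma sum_sample_weight_card:
  assumes "finite V" "finite A" "\<And>a. a \<in> A \<Longrightarrow> T a \<subseteq> V"
  shows "(\<Sum>S\<in>Pow V. sample_weight p V S * real (card {a \<in> A. T a \<subseteq> S})) = (\<Sum>a\<in>A. p ^ card (T a))"
proof -
  have "(\<Sum>S\<in>Pow V. sample_weight p V S * real (card {a \<in> A. T a \<subseteq> S})) =
      (\<Sum>S\<in>Pow V. \<Sum>a\<in>A. sample_weight p V S * of_bool (T a \<subseteq> S))"
    using assms(2) by (simp add: sum_distrib_left[symmetric] Int_def conj_commute)
  also have "\<dots> = (\<Sum>a\<in>A. \<Sum>S\<in>Pow V. sample_weight p V S * of_bool (T a \<subseteq> S))"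
    by (rule sum.swap)
  also have "\<dots> = (\<Sum>a\<in>A. p ^ card (T a))"
    by (intro sum.cong refl sum_sample_weight_superset assms)
  finally show ?thesis .
qed

text \<open>The weak bound holds for the subdrawing induced by every outcome \<open>S\<close>.
  Taking expectations, a vertex survives with probability \<open>p\<close>, an edge with
  \<open>p\<^sup>2\<close>, a crossing with \<open>p ^ 4\<close>.\<close>

lemma crossing_sampled:
  fixes p :: real
  assumes d: "drawing V E" and p: "0 \<le> p" "p \<le> 1"
  shows "p\<^sup>2 * card E \<le> 3 * p * card V + p ^ 4 * card (crossing_pairs E)"
proof -
  have finV: "finite V" and finE: "finite E" and EV: "\<And>e. e \<in> E \<Longrightarrow> fst e \<in> V \<and> snd e \<in> V"
    and lr: "\<And>e. e \<in> E \<Longrightarrow> xl e < xr e"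
    using d drawing_finite by (auto simp: drawing_def)
  let ?C = "crossing_pairs E"
  let ?ends = "\<lambda>e::edge. {fst e, snd e}"
  let ?ends2 = "\<lambda>c::edge \<times> edge. {fst (fst c), snd (fst c), fst (snd c), snd (snd c)}"
  let ?w = "sample_weight p V"
  have "?w S * card {e \<in> E. ?ends e \<subseteq> S} \<le>
      3 * (?w S * card {v \<in> V. {v} \<subseteq> S}) + ?w S * card {c \<in> ?C. ?ends2 c \<subseteq> S}"
    if S: "S \<in> Pow V" for S
  proof -
    let ?ES = "{e \<in> E. fst e \<in> S \<and> snd e \<in> S}"
    have "card ?ES \<le> 3 * card S + card (crossing_pairs ?ES)"
      using drawing_restrict[OF d] S by (intro card_edges_le_crossing) auto
    moreover have "crossing_pairs ?ES = {c \<in> ?C. ?ends2 c \<subseteq> S}" by (auto simp: crossing_pairs_def)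
    moreover have "{v \<in> V. {v} \<subseteq> S} = S" using S by auto
    ultimately have "real (card {e \<in> E. ?ends e \<subseteq> S}) \<le>
        3 * card {v \<in> V. {v} \<subseteq> S} + card {c \<in> ?C. ?ends2 c \<subseteq> S}"
      by simp
    moreover have "0 \<le> ?w S" using p by (simp add: sample_weight_def)
    ultimately show ?thesis
      using mult_left_mono[of _ _ "?w S"] by (fastforce simp: algebra_simps)
  qed
  then have "(\<Sum>S\<in>Pow V. ?w S * card {e \<in> E. ?ends e \<subseteq> S}) \<le>
      (\<Sum>S\<in>Pow V. 3 * (?w S * card {v \<in> V. {v} \<subseteq> S}) + ?w S * card {c \<in> ?C. ?ends2 c \<subseteq> S})"
    by (rule sum_mono)
  also have "\<dots> = 3 * (\<Sum>S\<in>Pow V. ?w S * card {v \<in> V. {v} \<subseteq> S}) +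
      (\<Sum>S\<in>Pow V. ?w S * card {c \<in> ?C. ?ends2 c \<subseteq> S})"
    by (simp add: sum.distrib sum_distrib_left)
  also have "(\<Sum>S\<in>Pow V. ?w S * card {v \<in> V. {v} \<subseteq> S}) = (\<Sum>v\<in>V. p ^ card {v})"
    using finV by (intro sum_sample_weight_card) auto
  also have "(\<Sum>S\<in>Pow V. ?w S * card {c \<in> ?C. ?ends2 c \<subseteq> S}) = (\<Sum>c\<in>?C. p ^ card (?ends2 c))"
    using finV finite_crossing_pairs[OF finE] EV
    by (intro sum_sample_weight_card) (auto simp: crossing_pairs_def)
  also have "\<dots> = (\<Sum>c\<in>?C. p ^ 4)"
    using crosses_distinct_ends[OF d] by (intro sum.cong refl) (auto simp: crossing_pairs_def)
  also have "(\<Sum>S\<in>Pow V. ?w S * card {e \<in> E. ?ends e \<subseteq> S}) = (\<Sum>e\<in>E. p ^ card (?ends e))"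
    using finV finE EV by (intro sum_sample_weight_card) auto
  also have "\<dots> = (\<Sum>e\<in>E. p\<^sup>2)"
  proof (intro sum.cong refl)
    fix e assume "e \<in> E"
    then have "fst e \<noteq> snd e" using lr by fastforce
    then show "p ^ card (?ends e) = p\<^sup>2" by (simp add: numeral_2_eq_2)
  qed
  finally show ?thesis by (simp add: mult.commute mult.left_commute)
qed

lemma crossing_lemma:
  assumes d: "drawing V E" and large: "6 * card V \<le> card E"
  shows "real (card E) ^ 3 \<le> 72 * (real (card V))\<^sup>2 * card (crossing_pairs E)"
proof (cases "card E = 0")
  case False
  define e v c where "e = real (card E)" and "v = real (card V)" and "c = real (card (crossing_pairs E))"
  have e: "e > 0" and v: "v \<ge> 0" and l: "6 * v \<le> e"
    using False large by (simp_all add: e_def v_def)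
  have "V \<noteq> {}" using False d by (auto simp: drawing_def)
  then have v: "v > 0" using d by (simp add: v_def drawing_def card_gt_0_iff)
  \<comment> \<open>With this choice the vertex term \<open>3 * p * v\<close> is exactly half of
    \<open>p\<^sup>2 * e\<close>, leaving the other half to the crossings;
    \<open>6 * v \<le> e\<close> makes \<open>p\<close> a probability.\<close>
  define p where "p = 6 * v / e"
  have "p\<^sup>2 * e \<le> 3 * p * v + p ^ 4 * c"
    unfolding e_def v_def c_def using l e v
    by (intro crossing_sampled[OF d]) (auto simp: p_def)
  moreover have "p\<^sup>2 * e = 36 * v\<^sup>2 / e" "3 * p * v = 18 * v\<^sup>2 / e" "p ^ 4 * c = 1296 * v ^ 4 * c / e ^ 4"
    using e by (auto simp: p_def field_simps power2_eq_square power_def numeral_eq_Suc)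
  ultimately have "18 * v\<^sup>2 / e \<le> 1296 * v ^ 4 * c / e ^ 4" by simp
  then have "18 * v\<^sup>2 / e * (e ^ 4 / (18 * v\<^sup>2)) \<le> 1296 * v ^ 4 * c / e ^ 4 * (e ^ 4 / (18 * v\<^sup>2))"
    using e v by (intro mult_right_mono) auto
  moreover have "18 * v\<^sup>2 / e * (e ^ 4 / (18 * v\<^sup>2)) = e ^ 3"
    using e v by (simp add: field_simps eval_nat_numeral)
  moreover have "1296 * v ^ 4 * c / e ^ 4 * (e ^ 4 / (18 * v\<^sup>2)) = 72 * v\<^sup>2 * c"
    using e v by (simp add: field_simps eval_nat_numeral)
  ultimately show ?thesis by (simp add: e_def v_def c_def)
qed auto

section \<open>The Szemeredi--Trotter bound\<close>

text \<open>A pair \<open>(s, t)\<close> stands for the line \<open>y = s * x + t\<close>; vertical lines are never needed.\<close>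

definition edge_line :: "edge \<Rightarrow> real \<times> real" where
  "edge_line e = (slope e, height e 0)"

definition incidences :: "point set \<Rightarrow> (real \<times> real) set \<Rightarrow> (point \<times> (real \<times> real)) set" where
  "incidences P L = {(q, l) \<in> P \<times> L. snd q = fst l * fst q + snd l}"

text \<open>The graph of Szekely's argument: neighbouring points of \<open>P\<close> along a line of
  \<open>L\<close> are joined.\<close>

definition consecutive :: "point set \<Rightarrow> (real \<times> real) set \<Rightarrow> edge set" where
  "consecutive P L = {e \<in> P \<times> P. xl e < xr e \<and> edge_line e \<in> L \<and>
     (\<forall>r\<in>P. xl e < fst r \<and> fst r < xr e \<longrightarrow> snd r \<noteq> height e (fst r))}"

lemma height_edge_line: "height e x = fst (edge_line e) * x + snd (edge_line e)"
  using height_eq[of e x 0] by (simp add: edge_line_def)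

lemma edge_line_eqI:
  assumes "fst p < fst q" "snd p = fst l * fst p + snd l" "snd q = fst l * fst q + snd l"
  shows "edge_line (p, q) = l"
proof -
  have "snd q - snd p = fst l * (fst q - fst p)" using assms by (simp add: algebra_simps)
  then have "slope (p, q) = fst l" using assms(1) by (simp add: slope_def)
  then show ?thesis using assms(2) by (simp add: edge_line_def height_def prod_eq_iff)
qed

lemma drawing_consecutive: "finite P \<Longrightarrow> drawing P (consecutive P L)"
  unfolding drawing_def consecutive_def by blast

text \<open>Neither of two overlapping segments on one line can have an end point of the other in
  its interior, so they share both ends.\<close>

lemma consecutive_eqI:
  assumes e: "e \<in> consecutive P L" and f: "f \<in> consecutive P L"
    and line: "edge_line e = edge_line f"
    and x: "xl e < x" "x < xr e" "xl f < x" "x < xr f"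
  shows "e = f"
proof -
  have h: "height e y = height f y" for y using line by (simp add: height_edge_line)
  have av: "\<And>e r. e \<in> consecutive P L \<Longrightarrow> r \<in> P \<Longrightarrow> xl e < fst r \<Longrightarrow> fst r < xr e \<Longrightarrow>
      snd r \<noteq> height e (fst r)"
    and P: "fst e \<in> P" "snd e \<in> P" "fst f \<in> P" "snd f \<in> P"
    and lr: "xl e < xr e" "xl f < xr f"
    using e f by (simp_all add: consecutive_def mem_Times_iff)
  have "\<not> xl e < xl f" using av[OF e P(3)] x h[of "xl f"] by auto
  moreover have "\<not> xl f < xl e" using av[OF f P(1)] x h[of "xl e"] by auto
  ultimately have l: "xl e = xl f" by simp
  have "\<not> xr f < xr e" using av[OF e P(4)] x h[of "xr f"] height_right[OF lr(2)] by auto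
  moreover have "\<not> xr e < xr f" using av[OF f P(2)] x h[of "xr e"] height_right[OF lr(1)] by auto
  ultimately have r: "xr e = xr f" by simp
  have "snd (fst e) = snd (fst f)" using h[of "xl e"] l by (metis height_left)
  moreover have "snd (snd e) = snd (snd f)"
    using h[of "xr e"] r height_right[OF lr(1)] height_right[OF lr(2)] by simp
  ultimately show ?thesis using l r by (simp add: prod_eq_iff)
qed

text \<open>Crossing edges lie on different lines, which meet only once, and a line together with a
  point on it determines the edge around that point. So a pair of lines determines the crossing
  pair.\<close>

lemma card_crossing_consecutive:
  assumes "finite P" "finite L"
  shows "card (crossing_pairs (consecutive P L)) \<le> card L ^ 2"
proof -
  let ?E = "consecutive P L"
  let ?f = "\<lambda>c. (edge_line (fst c), edge_line (snd c))"
  have "inj_on ?f (crossing_pairs ?E)"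
  proof (rule inj_onI)
    fix c d assume c: "c \<in> crossing_pairs ?E" and d: "d \<in> crossing_pairs ?E" and eq: "?f c = ?f d"
    have cr: "crosses (fst c) (snd c)" "crosses (fst d) (snd d)"
      and E: "fst c \<in> ?E" "snd c \<in> ?E" "fst d \<in> ?E" "snd d \<in> ?E"
      using c d by (simp_all add: crossing_pairs_def case_prod_unfold mem_Times_iff)
    obtain x where x: "xl (fst c) < x" "x < xr (fst c)" "xl (snd c) < x" "x < xr (snd c)"
      "height (fst c) x = height (snd c) x" and ne: "fst c \<noteq> snd c"
      using cr(1) unfolding crosses_def by blast
    obtain y where y: "xl (fst d) < y" "y < xr (fst d)" "xl (snd d) < y" "y < xr (snd d)"
      "height (fst d) y = height (snd d) y"
      using cr(2) unfolding crosses_def by blast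
    define l k where "l = edge_line (fst c)" and "k = edge_line (snd c)"
    have "l \<noteq> k" using consecutive_eqI[OF E(1,2) _ x(1-4)] ne by (auto simp: l_def k_def)
    have lx: "fst l * x + snd l = fst k * x + snd k"
      using x(5) by (simp add: height_edge_line l_def k_def)
    have ly: "fst l * y + snd l = fst k * y + snd k"
      using y(5) eq by (simp add: height_edge_line l_def k_def)
    have "fst l \<noteq> fst k" using \<open>l \<noteq> k\<close> lx by (auto simp: prod_eq_iff)
    moreover have "(fst l - fst k) * (x - y) = 0" using lx ly by (simp add: algebra_simps)
    ultimately have "x = y" by simp
    then have "fst c = fst d" "snd c = snd d"
      using consecutive_eqI[OF E(1,3), of x] consecutive_eqI[OF E(2,4), of x] x y eq by auto
    then show "c = d" by (simp add: prod_eq_iff)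
  qed
  moreover have "?f ` crossing_pairs ?E \<subseteq> L \<times> L"
    by (auto simp: crossing_pairs_def consecutive_def)
  ultimately have "card (crossing_pairs ?E) \<le> card (L \<times> L)"
    using assms by (intro card_inj_on_le) auto
  then show ?thesis by (simp add: card_cartesian_product power2_eq_square)
qed

text \<open>Along each line, every point but the leftmost is the right end of the edge from its
  predecessor. The leftmost points, collected in \<open>?F\<close>, account for the term
  \<open>card L\<close>.\<close>

lemma card_incidences_le:
  assumes "finite P" "finite L"
  shows "card (incidences P L) \<le> card L + card (consecutive P L)"
proof -
  let ?I = "incidences P L" and ?E = "consecutive P L"
  let ?on = "\<lambda>r l. snd r = fst l * fst r + (snd l :: real)"
  let ?F = "{c \<in> ?I. \<forall>r\<in>P. ?on r (snd c) \<longrightarrow> fst (fst c) \<le> fst r}"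
  have finE: "finite ?E" by (rule drawing_finite[OF drawing_consecutive[OF assms(1)]])
  have finI: "finite ?I"
    unfolding incidences_def by (rule finite_subset[of _ "P \<times> L"]) (use assms in auto)
  have "inj_on snd ?F"
  proof (rule inj_onI)
    fix c d assume c: "c \<in> ?F" and d: "d \<in> ?F" and eq: "snd c = snd d"
    have "fst c \<in> P" "fst d \<in> P" "?on (fst c) (snd c)" "?on (fst d) (snd c)"
      using c d eq by (auto simp: incidences_def)
    moreover from this have "fst (fst c) = fst (fst d)" using c d eq by (simp add: order_antisym)
    ultimately show "c = d" using eq by (simp add: prod_eq_iff)
  qed
  then have cF: "card ?F \<le> card L"
    using assms by (intro card_inj_on_le[of snd]) (auto simp: incidences_def)
  have "?I \<subseteq> ?F \<union> (\<lambda>e. (snd e, edge_line e)) ` ?E"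
  proof
    fix c assume c: "c \<in> ?I"
    define q l where "q = fst c" and "l = snd c"
    have ql: "q \<in> P" "l \<in> L" "?on q l" "c = (q, l)"
      using c by (auto simp: incidences_def q_def l_def)
    define R where "R = {r \<in> P. ?on r l \<and> fst r < fst q}"
    show "c \<in> ?F \<union> (\<lambda>e. (snd e, edge_line e)) ` ?E"
    proof (cases "R = {}")
      case True
      then have "c \<in> ?F" using c ql by (auto simp: R_def not_le[symmetric])
      then show ?thesis by simp
    next
      case False
      have "finite R" using assms by (simp add: R_def)
      then obtain p where pR: "p \<in> R" and pmax: "\<And>r. r \<in> R \<Longrightarrow> fst r \<le> fst p"
        using arg_min_if_finite[OF _ False, of "\<lambda>r. - fst r"] by (metis neg_less_iff_less not_le)
      have p: "p \<in> P" "?on p l" "fst p < fst q" using pR by (auto simp: R_def)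
      have line: "edge_line (p, q) = l" by (rule edge_line_eqI[OF p(3,2) ql(3)])
      have "snd r \<noteq> height (p, q) (fst r)" if r: "r \<in> P" "fst p < fst r" "fst r < fst q" for r
      proof
        assume "snd r = height (p, q) (fst r)"
        then have "r \<in> R" using r by (simp add: R_def height_edge_line line)
        then show False using pmax r(2) by fastforce
      qed
      then have "(p, q) \<in> ?E" using p ql line by (simp add: consecutive_def)
      then show ?thesis using ql line by (intro UnI2 image_eqI[of _ _ "(p, q)"]) simp_all
    qed
  qed
  then have "card ?I \<le> card (?F \<union> (\<lambda>e. (snd e, edge_line e)) ` ?E)"
    using finI finE by (intro card_mono) auto
  also have "\<dots> \<le> card ?F + card ((\<lambda>e. (snd e, edge_line e)) ` ?E)" by (rule card_Un_le)
  also have "\<dots> \<le> card L + card ?E" using cF card_image_le[OF finE] by (rule add_mono)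
  finally show ?thesis .
qed

text \<open>The usual estimate in cubed form, which avoids fractional powers. The first alternative
  covers the case of too few edges for the crossing lemma.\<close>

theorem Szemeredi_Trotter:
  assumes "finite P" "finite L"
  shows "real (card (incidences P L)) \<le> real (card L) + 6 * real (card P) \<or>
    (real (card (incidences P L)) - real (card L)) ^ 3 \<le> 72 * (real (card P))\<^sup>2 * (real (card L))\<^sup>2"
proof (cases "6 * card P \<le> card (consecutive P L)")
  case False
  then show ?thesis using card_incidences_le[OF assms] by linarith
next
  case True
  have "(real (card (incidences P L)) - real (card L)) ^ 3 \<le> real (card (consecutive P L)) ^ 3"
    using card_incidences_le[OF assms] by (intro power_mono_odd) auto
  also have "\<dots> \<le> 72 * (real (card P))\<^sup>2 * card (crossing_pairs (consecutive P L))"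
    by (rule crossing_lemma[OF drawing_consecutive[OF assms(1)] True])
  also have "\<dots> \<le> 72 * (real (card P))\<^sup>2 * real (card L ^ 2)"
    using card_crossing_consecutive[OF assms] by (intro mult_left_mono) (simp_all del: of_nat_power)
  finally show ?thesis by simp
qed

section \<open>Distances from a line\<close>

text \<open>The distance 0 is kept here, unlike in \<open>num_dist\<close>, so that every pair of
  points yields an incidence; the counts differ by at most one.\<close>

definition dist_set :: "(real^2) set \<Rightarrow> (real^2) set \<Rightarrow> real set" where
  "dist_set P1 P2 = (\<lambda>(a, b). dist a b) ` (P1 \<times> P2)"

lemma card_dist_set_le:
  assumes "finite P1" "finite P2"
  shows "card (dist_set P1 P2) \<le> num_dist P1 P2 + 1"
proof -
  let ?D = "{dist a b | a b. a \<in> P1 \<and> b \<in> P2 \<and> dist a b > 0}"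
  have sub: "?D \<subseteq> dist_set P1 P2" "dist_set P1 P2 \<subseteq> insert 0 ?D" by (force simp: dist_set_def)+
  have "finite (dist_set P1 P2)" using assms by (simp add: dist_set_def)
  then have "finite ?D" by (rule finite_subset[OF sub(1)])
  then show ?thesis
    using card_mono[OF _ sub(2)] card_insert_le_m1[of "num_dist P1 P2 + 1" ?D 0]
    by (simp add: num_dist_def)
qed

text \<open>Serves to absorb the extra distance 0 into a factor 2, and to settle the case of a
  single point on the line.\<close>

lemma num_dist_pos:
  assumes "finite P1" "finite P2" "P1 \<noteq> {}" "card P2 \<ge> 2"
  shows "num_dist P1 P2 \<ge> 1"
proof -
  let ?D = "{dist a b | a b. a \<in> P1 \<and> b \<in> P2 \<and> dist a b > 0}"
  obtain a where a: "a \<in> P1" using assms by auto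
  have "\<not> P2 \<subseteq> {a}" using card_mono[of "{a}" P2] assms(4) by auto
  then obtain b where b: "b \<in> P2" "b \<noteq> a" by auto
  have "dist a b \<in> ?D" using a b by auto
  moreover have "finite ?D"
    by (rule finite_subset[of _ "(\<lambda>(a, b). dist a b) ` (P1 \<times> P2)"]) (use assms in force)+
  ultimately have "card ?D > 0" by (auto simp: card_gt_0_iff)
  then show ?thesis by (simp add: num_dist_def)
qed

section \<open>Lifting circles centred on the line to straight lines\<close>

definition rot :: "real^2 \<Rightarrow> real^2" where
  "rot u = vector [- (u $ 2), u $ 1]"

text \<open>Pythagoras in the directions \<open>u\<close> and \<open>rot u\<close>: the norm of
  \<open>v\<close> and \<open>v \<bullet> u\<close> fix \<open>v \<bullet> rot u\<close> up to
  sign.\<close>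

lemma lagrange_identity_2: "(v \<bullet> v) * (u \<bullet> u) = (v \<bullet> u)\<^sup>2 + (v \<bullet> rot u)\<^sup>2"
  by (simp add: inner_vec_def sum_2 rot_def vector_2 power2_eq_square algebra_simps)

text \<open>The map \<open>b \<mapsto> ((b - o) \<bullet> u, \<parallel>b - o\<parallel>\<^sup>2)\<close> turns circles centred on the line \<open>o + t u\<close> into
  straight lines, and identifies only points that are mirror images in that line.\<close>

definition lift :: "real^2 \<Rightarrow> real^2 \<Rightarrow> real^2 \<Rightarrow> point" where
  "lift z u b = ((b - z) \<bullet> u, (b - z) \<bullet> (b - z))"

text \<open>For fixed \<open>t\<close> and fixed distance \<open>d\<close> this is the equation of a
  straight line of slope \<open>2 * t\<close> in the lifted coordinates.\<close>

lemma dist_lift: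
  "(dist (z + t *\<^sub>R u) b)\<^sup>2 = snd (lift z u b) - 2 * t * fst (lift z u b) + t\<^sup>2 * (u \<bullet> u)"
proof -
  have "z + t *\<^sub>R u - b = t *\<^sub>R u - (b - z)" by simp
  then show ?thesis
    unfolding dist_norm power2_norm_eq_inner lift_def
    by (simp only: inner_diff_left inner_diff_right inner_scaleR_left inner_scaleR_right fst_conv snd_conv)
      (simp add: inner_commute power2_eq_square algebra_simps)
qed

text \<open>One extra bit, the side of the line on which \<open>b\<close> lies, makes the lift
  injective.\<close>

lemma card_lift:
  assumes "finite B" "u \<noteq> 0"
  shows "card B \<le> 2 * card (lift z u ` B)"
proof -
  let ?f = "\<lambda>b. (lift z u b, 0 \<le> (b - z) \<bullet> rot u)"
  have "inj_on ?f B"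
  proof (rule inj_onI)
    fix b c assume eq: "?f b = ?f c"
    define v w where "v = b - z" and "w = c - z"
    have vw: "v \<bullet> u = w \<bullet> u" "v \<bullet> v = w \<bullet> w" "0 \<le> v \<bullet> rot u \<longleftrightarrow> 0 \<le> w \<bullet> rot u"
      using eq by (auto simp: lift_def v_def w_def)
    then have "(v \<bullet> rot u)\<^sup>2 = (w \<bullet> rot u)\<^sup>2"
      using lagrange_identity_2[of v u] lagrange_identity_2[of w u] by simp
    then have "v \<bullet> rot u = w \<bullet> rot u" using vw(3) by (auto simp: power2_eq_iff)
    then have "((v - w) \<bullet> (v - w)) * (u \<bullet> u) = 0"
      using vw(1) lagrange_identity_2[of "v - w" u] by (simp add: inner_diff_left)
    then show "b = c" using assms(2) by (simp add: v_def w_def)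
  qed
  then have "card B \<le> card (lift z u ` B \<times> (UNIV :: bool set))"
    using assms by (intro card_inj_on_le[of ?f]) auto
  then show ?thesis by (simp add: card_cartesian_product)
qed

text \<open>A circle about one fixed \<open>b\<close> meets the line in at most two points, told
  apart by their side of the foot of the perpendicular from \<open>b\<close>.\<close>

lemma card_le_dist_set:
  assumes fin: "finite T" "finite B" and B: "B \<noteq> {}" and u: "u \<noteq> 0"
  shows "card T \<le> 2 * card (dist_set ((\<lambda>t. z + t *\<^sub>R u) ` T) B)"
proof -
  let ?D = "dist_set ((\<lambda>t. z + t *\<^sub>R u) ` T) B"
  obtain b where b: "b \<in> B" using B by auto
  define x where "x = fst (lift z u b)"
  let ?f = "\<lambda>t. (dist (z + t *\<^sub>R u) b, x \<le> t * (u \<bullet> u))"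
  have "inj_on ?f T"
  proof (rule inj_onI)
    fix s t assume eq: "?f s = ?f t"
    then have "(dist (z + s *\<^sub>R u) b)\<^sup>2 = (dist (z + t *\<^sub>R u) b)\<^sup>2" by simp
    then have "s\<^sup>2 * (u \<bullet> u) - 2 * s * x = t\<^sup>2 * (u \<bullet> u) - 2 * t * x"
      unfolding dist_lift x_def by simp
    then have "(s - t) * ((s * (u \<bullet> u) - x) + (t * (u \<bullet> u) - x)) = 0"
      by (simp add: algebra_simps power2_eq_square)
    then consider "s = t" | "(s * (u \<bullet> u) - x) + (t * (u \<bullet> u) - x) = 0" by auto
    then show "s = t"
    proof cases
      case 2
      moreover have "x \<le> s * (u \<bullet> u) \<longleftrightarrow> x \<le> t * (u \<bullet> u)" using eq by simp
      ultimately have "s * (u \<bullet> u) = t * (u \<bullet> u)" by argo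
      then show ?thesis using u by simp
    qed
  qed
  moreover have "?f ` T \<subseteq> ?D \<times> UNIV" using b by (auto simp: dist_set_def)
  moreover have "finite ?D" using fin by (simp add: dist_set_def)
  ultimately have "card T \<le> card (?D \<times> (UNIV :: bool set))" by (intro card_inj_on_le) auto
  then show ?thesis by (simp add: card_cartesian_product)
qed

text \<open>The squared distances to two fixed points of the line are two independent linear data,
  which determine the lifted point.\<close>

lemma card_lift_le_dist_set:
  assumes fin: "finite T" "finite B" and T: "card T \<ge> 2"
  shows "card (lift z u ` B) \<le> card (dist_set ((\<lambda>t. z + t *\<^sub>R u) ` T) B) ^ 2"
proof -
  let ?D = "dist_set ((\<lambda>t. z + t *\<^sub>R u) ` T) B"
  obtain s t where st: "s \<in> T" "t \<in> T" "s \<noteq> t"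
    using T card_le_Suc0_iff_eq[OF fin(1)] by fastforce
  let ?g = "\<lambda>t q. snd q - 2 * t * fst q + t\<^sup>2 * (u \<bullet> u)"
  let ?f = "\<lambda>q. (?g s q, ?g t q)"
  let ?S = "(\<lambda>d. d\<^sup>2) ` ?D"
  have "inj_on ?f (lift z u ` B)"
  proof (rule inj_onI)
    fix q r assume eq: "?f q = ?f r"
    then have "(s - t) * (fst q - fst r) = 0" by (simp add: algebra_simps)
    with st have "fst q = fst r" by simp
    with eq show "q = r" by (simp add: prod_eq_iff)
  qed
  moreover have "?g t q \<in> ?S" if "t \<in> T" "q \<in> lift z u ` B" for t q
    using that by (force simp: dist_set_def dist_lift[symmetric])
  then have "?f ` lift z u ` B \<subseteq> ?S \<times> ?S" using st by blast
  moreover have finD: "finite ?D" using fin by (simp add: dist_set_def)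
  ultimately have "card (lift z u ` B) \<le> card (?S \<times> ?S)" by (intro card_inj_on_le) auto
  also have "\<dots> \<le> card ?D ^ 2"
    unfolding card_cartesian_product power2_eq_square[of "card ?D"]
    by (intro mult_le_mono card_image_le finD)
  finally show ?thesis .
qed

text \<open>Each pair of a parameter and a distance gives one line, and each lifted point lies on
  such a line for every \<open>t\<close>. The slope \<open>2 * t\<close> recovers \<open>t\<close>,
  so these incidences are distinct.\<close>

lemma incidences_lift:
  fixes z u :: "real^2"
  assumes fin: "finite T" "finite B"
  defines "D \<equiv> dist_set ((\<lambda>t. z + t *\<^sub>R u) ` T) B"
  obtains L where "finite L" "card L \<le> card T * card D"
    "card T * card (lift z u ` B) \<le> card (incidences (lift z u ` B) L)"
proof -
  let ?L = "(\<lambda>(t, d). (2 * t, d\<^sup>2 - t\<^sup>2 * (u \<bullet> u))) ` (T \<times> D)"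
  let ?Q = "lift z u ` B"
  have finD: "finite D" using fin by (simp add: D_def dist_set_def)
  have finL: "finite ?L" using fin finD by simp
  have "card ?L \<le> card (T \<times> D)" by (rule card_image_le) (use fin finD in auto)
  then have cardL: "card ?L \<le> card T * card D" by (simp only: card_cartesian_product)
  let ?f = "\<lambda>(t, q). (q, (2 * t, snd q - 2 * t * fst q))"
  have "?f ` (T \<times> ?Q) \<subseteq> incidences ?Q ?L"
  proof (rule image_subsetI)
    fix c assume "c \<in> T \<times> ?Q"
    then obtain t b where tb: "t \<in> T" "b \<in> B" and c: "c = (t, lift z u b)" by auto
    let ?q = "lift z u b"
    have "dist (z + t *\<^sub>R u) b \<in> D" using tb by (auto simp: D_def dist_set_def)
    moreover have "snd ?q - 2 * t * fst ?q = (dist (z + t *\<^sub>R u) b)\<^sup>2 - t\<^sup>2 * (u \<bullet> u)"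
      by (simp add: dist_lift)
    ultimately have "(2 * t, snd ?q - 2 * t * fst ?q) \<in> ?L" using tb(1) by force
    then show "?f c \<in> incidences ?Q ?L" using tb by (simp add: incidences_def c)
  qed
  moreover have "inj_on ?f (T \<times> ?Q)" by (auto simp: inj_on_def)
  moreover have "finite (incidences ?Q ?L)"
    unfolding incidences_def by (rule finite_subset[of _ "?Q \<times> ?L"]) (use fin finL in auto)
  ultimately have "card (T \<times> ?Q) \<le> card (incidences ?Q ?L)" by (intro card_inj_on_le)
  then have "card T * card ?Q \<le> card (incidences ?Q ?L)" by (simp add: card_cartesian_product)
  with finL cardL show thesis by (rule that)
qed

text \<open>Here \<open>m\<close> and \<open>n\<close> count the given points, \<open>N\<close> the
  lifted points, \<open>x\<close> the distances including 0, \<open>l\<close> the lines and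
  \<open>i\<close> the incidences.\<close>

lemma distance_count_arith:
  fixes m n N x l i :: real
  assumes pos: "m > 0" "n > 0" "N > 0" "x > 0"
    and mx: "m \<le> 2 * x" and nN: "n \<le> 2 * N" and Nx: "N \<le> x\<^sup>2"
    and l: "0 \<le> l" "l \<le> m * x" and i: "m * N \<le> i"
    and ST: "i \<le> l + 6 * N \<or> (i - l) ^ 3 \<le> 72 * N\<^sup>2 * l\<^sup>2"
  shows "m * n \<le> 1152 * x\<^sup>2"
proof (cases "n \<le> m \<or> N \<le> 2 * x")
  case True
  then have "n \<le> 4 * x" using mx nN pos by auto
  then have "m * n \<le> (2 * x) * (4 * x)" using pos mx by (intro mult_mono) auto
  also have "\<dots> \<le> 1152 * x\<^sup>2" by (simp add: power2_eq_square)
  finally show ?thesis .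
next
  case False
  \<comment> \<open>Since \<open>N\<close> exceeds \<open>2 * x\<close>, the at most
    \<open>m * x\<close> lines amount to less than half of the incidences, so subtracting
    \<open>l\<close> is harmless.\<close>
  have "m * (2 * x) < m * N" using False pos by (intro mult_strict_left_mono) auto
  then have half: "m * N / 2 \<le> i - l" using l i by linarith
  from ST show ?thesis
  proof
    assume "i \<le> l + 6 * N"
    then have "m * N \<le> 12 * N" using half by linarith
    then have "m \<le> 12" using pos by simp
    then have "m * n \<le> 12 * (2 * N)" using pos nN by (intro mult_mono) auto
    then show ?thesis using Nx pos by linarith
  next
    assume *: "(i - l) ^ 3 \<le> 72 * N\<^sup>2 * l\<^sup>2"
    have "(m * N / 2) ^ 3 \<le> (i - l) ^ 3" using half pos by (intro power_mono) auto
    also note *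
    also have "72 * N\<^sup>2 * l\<^sup>2 \<le> 72 * N\<^sup>2 * (m * x)\<^sup>2"
      using l by (intro mult_left_mono power_mono) auto
    finally have "(m\<^sup>2 * N\<^sup>2) * (m * N) \<le> (m\<^sup>2 * N\<^sup>2) * (576 * x\<^sup>2)"
      by (simp add: power2_eq_square power3_eq_cube algebra_simps)
    then have "m * N \<le> 576 * x\<^sup>2" using pos by (subst (asm) mult_le_cancel_left_pos) auto
    moreover have "m * n \<le> m * (2 * N)" using pos nN by (intro mult_left_mono) auto
    ultimately show ?thesis by linarith
  qed
qed

lemma num_dist_collinear:
  assumes fin: "finite P1" "finite P2" and col: "collinear P1"
    and m: "card P1 \<ge> 2" and n: "card P2 \<ge> 2"
  shows "real (card P1) * real (card P2) \<le> (72 * real (num_dist P1 P2))\<^sup>2"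
proof -
  obtain u where u: "\<And>a b. a \<in> P1 \<Longrightarrow> b \<in> P1 \<Longrightarrow> \<exists>c. a - b = c *\<^sub>R u"
    using col by (auto simp: collinear_def)
  obtain z y where zy: "z \<in> P1" "y \<in> P1" "z \<noteq> y"
    using m card_le_Suc0_iff_eq[OF fin(1)] by fastforce
  have u0: "u \<noteq> 0" using u[OF zy(1,2)] zy(3) by auto
  define T where "T = {t. z + t *\<^sub>R u \<in> P1}"
  have inj: "inj (\<lambda>t. z + t *\<^sub>R u)" using u0 by (auto simp: inj_on_def)
  have P1: "P1 = (\<lambda>t. z + t *\<^sub>R u) ` T"
  proof
    show "P1 \<subseteq> (\<lambda>t. z + t *\<^sub>R u) ` T"
    proof
      fix a assume a: "a \<in> P1"
      then obtain c where "a - z = c *\<^sub>R u" using u zy(1) by blast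
      then have "a = z + c *\<^sub>R u" by (simp add: algebra_simps)
      with a show "a \<in> (\<lambda>t. z + t *\<^sub>R u) ` T" by (auto simp: T_def)
    qed
  qed (auto simp: T_def)
  have finT: "finite T" unfolding P1 using fin(1) inj P1 by (metis finite_imageD inj_on_subset subset_UNIV)
  have cT: "card P1 = card T" using inj P1 by (metis card_image inj_on_subset subset_UNIV)
  let ?Q = "lift z u ` P2" and ?D = "dist_set P1 P2"
  have ne: "P2 \<noteq> {}" "P1 \<noteq> {}" using n m by auto
  obtain L where L: "finite L" "card L \<le> card T * card ?D"
    "card T * card ?Q \<le> card (incidences ?Q L)"
    using incidences_lift[OF finT fin(2), of z u] P1 by auto
  have D1: "num_dist P1 P2 \<ge> 1" by (rule num_dist_pos[OF fin ne(2) n])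
  have D: "card ?D \<le> 2 * num_dist P1 P2"
    using card_dist_set_le[OF fin] D1 by linarith
  have "?Q \<noteq> {}" "?D \<noteq> {}" using ne by (auto simp: dist_set_def)
  then have pos: "card ?Q > 0" "card ?D > 0"
    using fin by (auto simp: card_gt_0_iff dist_set_def)
  have 1: "card P1 \<le> 2 * card ?D"
    using card_le_dist_set[OF finT fin(2) ne(1) u0, of z] P1 cT by simp
  have 2: "card P2 \<le> 2 * card ?Q" by (rule card_lift[OF fin(2) u0])
  have 3: "card ?Q \<le> card ?D ^ 2"
    using card_lift_le_dist_set[OF finT fin(2), of z u] m P1 cT by simp
  have "real (card P1) * real (card P2) \<le> 1152 * (real (card ?D))\<^sup>2"
  proof (rule distance_count_arith)
    show "real (card (incidences ?Q L)) \<le> real (card L) + 6 * real (card ?Q) \<or>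
      (real (card (incidences ?Q L)) - real (card L)) ^ 3 \<le> 72 * (real (card ?Q))\<^sup>2 * (real (card L))\<^sup>2"
      using fin L(1) by (intro Szemeredi_Trotter) auto
    show "real (card P1) \<le> 2 * real (card ?D)" using 1 by linarith
    show "real (card P2) \<le> 2 * real (card ?Q)" using 2 by linarith
    show "real (card ?Q) \<le> (real (card ?D))\<^sup>2" using 3 by (metis of_nat_le_iff of_nat_power)
    show "real (card L) \<le> real (card P1) * real (card ?D)"
      using L(2) cT by (metis of_nat_le_iff of_nat_mult)
    show "real (card P1) * real (card ?Q) \<le> real (card (incidences ?Q L))"
      using L(3) cT by (metis of_nat_le_iff of_nat_mult)
  qed (use m n pos in auto)
  also have "\<dots> \<le> 1152 * (2 * real (num_dist P1 P2))\<^sup>2"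
    using D by (intro mult_left_mono power_mono) auto
  \<comment> \<open>Here \<open>4 * 1152 = 4608\<close> is at most
    \<open>72\<^sup>2 = 5184\<close>.\<close>
  also have "\<dots> \<le> (72 * real (num_dist P1 P2))\<^sup>2" by (simp add: power_mult_distrib)
  finally show ?thesis .
qed

section \<open>From the uniform bound to the three ranges of \<open>m\<close>\<close>

lemma line_config_bound:
  assumes "line_config m n l P1 P2" "m \<ge> 2" "n \<ge> 2"
  shows "real m powr (1/2) * real n powr (1/2) \<le> 72 * real (num_dist P1 P2)"
proof -
  have "collinear l" "P1 \<subseteq> l"
    using assms(1) by (auto simp: line_config_def is_line_def collinear_aff_dim)
  then have "collinear P1" by (rule collinear_subset)
  then have "real m * real n \<le> (72 * real (num_dist P1 P2))\<^sup>2"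
    using num_dist_collinear[of P1 P2] assms by (auto simp: line_config_def)
  then have "sqrt (real m * real n) \<le> 72 * real (num_dist P1 P2)" by (simp add: real_le_lsqrt)
  then show ?thesis by (simp add: powr_half_sqrt real_sqrt_mult)
qed

lemma line_config_pos:
  assumes "line_config m n l P1 P2" "m \<ge> 1" "n \<ge> 2"
  shows "real (num_dist P1 P2) \<ge> 1"
  using num_dist_pos[of P1 P2] assms by (force simp: line_config_def)

text \<open>For \<open>n = 2\<close> the logarithm is below 1 and its negative powers exceed 1;
  \<open>ln 2 \<ge> 1/2\<close> still keeps them at most 2.\<close>

lemma ln_powr_le:
  assumes "n \<ge> 2" "0 \<le> a" "a \<le> 1"
  shows "ln (real n) powr (- a) \<le> 2"
proof -
  have "exp (1/2 :: real) \<le> 2"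
    using exp_bound_half[of "1/2 :: real"] by simp
  then have "1/2 \<le> ln (2 :: real)" by (subst ln_ge_iff) simp_all
  also have "\<dots> \<le> ln (real n)" using assms by simp
  finally have "ln (real n) powr (- a) \<le> (1/2) powr (- a)"
    using assms by (intro powr_mono2') auto
  also have "\<dots> = 2 powr a" by (simp add: powr_minus powr_divide)
  also have "\<dots> \<le> 2 powr 1" using assms by (intro powr_mono) auto
  finally show ?thesis by simp
qed

theorem theorem1p6:
  shows
    "(\<forall>A::real. A > 0 \<longrightarrow> (\<exists>c::real. c > 0 \<and>
        (\<forall>m n l P1 P2. line_config m n l P1 P2 \<and> n \<ge> 2 \<and>
           real m \<ge> A * (real n powr (1/2) / ln (real n) powr (1/3)) \<longrightarrow>
           real (num_dist P1 P2)
             \<ge> c * (real m powr (1/2) * real n powr (1/2) * ln (real n) powr (-1/2)))))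
   \<and> (\<forall>A B::real. A > 0 \<and> B > 0 \<longrightarrow> (\<exists>c::real. c > 0 \<and>
        (\<forall>m n l P1 P2. line_config m n l P1 P2 \<and> n \<ge> 2 \<and>
           real m \<le> B * (real n powr (1/2) / ln (real n) powr (1/3)) \<and>
           real m \<ge> A * real n powr (3/10) \<longrightarrow>
           real (num_dist P1 P2) \<ge> c * (real n powr (3/8) * real m powr (3/4)))))
   \<and> (\<forall>B::real. B > 0 \<longrightarrow> (\<exists>c::real. c > 0 \<and>
        (\<forall>m n l P1 P2. line_config m n l P1 P2 \<and> n \<ge> 2 \<and> m \<ge> 2 \<and>
           real m \<le> B * real n powr (3/10) \<longrightarrow>
           real (num_dist P1 P2) \<ge> c * (real n powr (1/2) * real m powr (1/3)))))"
proof (intro conjI allI impI)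
  fix A :: real assume A: "A > 0"
  show "\<exists>c::real. c > 0 \<and>
        (\<forall>m n l P1 P2. line_config m n l P1 P2 \<and> n \<ge> 2 \<and>
           real m \<ge> A * (real n powr (1/2) / ln (real n) powr (1/3)) \<longrightarrow>
           real (num_dist P1 P2)
             \<ge> c * (real m powr (1/2) * real n powr (1/2) * ln (real n) powr (-1/2)))"
  \<comment> \<open>The value \<open>1/144\<close> combines the 72 of
    \<open>line_config_bound\<close> with the 2 of \<open>ln_powr_le\<close>; \<open>A/2\<close>
    serves \<open>m = 1\<close>.\<close>
  proof (intro exI[of _ "min (1/144) (A/2)"] conjI allI impI)
    fix m n l P1 P2
    assume "line_config m n l P1 P2 \<and> n \<ge> 2 \<and>
      real m \<ge> A * (real n powr (1/2) / ln (real n) powr (1/3))"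
    then have cfg: "line_config m n l P1 P2" and n: "n \<ge> 2"
      and mA: "real m \<ge> A * (real n powr (1/2) / ln (real n) powr (1/3))" by auto
    have ln: "ln (real n) > 0" using n by simp
    then have "A * (real n powr (1/2) / ln (real n) powr (1/3)) > 0" using A n by simp
    then have m1: "m \<ge> 1" using mA by (cases m) auto
    let ?c = "min (1/144) (A/2)" and ?d = "real (num_dist P1 P2)"
    let ?s = "real m powr (1/2) * real n powr (1/2)" and ?l = "ln (real n) powr (-1/2)"
    show "?c * (?s * ?l) \<le> ?d"
    proof (cases "m = 1")
      case False
      have "?s * ?l \<le> (72 * ?d) * 2"
        by (rule mult_mono) (use line_config_bound[OF cfg] ln_powr_le[OF n, of "1/2"] False m1 n in auto)
      then have "1/144 * (?s * ?l) \<le> ?d" by simp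
      moreover have "?c * (?s * ?l) \<le> 1/144 * (?s * ?l)" by (intro mult_right_mono) auto
      ultimately show ?thesis by linarith
    next
      case True
      \<comment> \<open>Splitting the exponent isolates the expression that the hypothesis bounds by
        \<open>m = 1\<close>; the remaining power of the logarithm is at most 2.\<close>
      have "?l = ln (real n) powr (-1/6) / ln (real n) powr (1/3)" by (simp flip: powr_diff)
      then have "A/2 * (?s * ?l) =
          (A * (real n powr (1/2) / ln (real n) powr (1/3))) * (ln (real n) powr (-1/6) / 2)"
        using True by simp
      also have "\<dots> \<le> 1 * 1"
        by (rule mult_mono) (use mA True ln_powr_le[OF n, of "1/6"] A in auto)
      also have "\<dots> \<le> ?d" using line_config_pos[OF cfg m1 n] by simp
      finally have "A/2 * (?s * ?l) \<le> ?d" .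
      moreover have "?c * (?s * ?l) \<le> A/2 * (?s * ?l)" by (intro mult_right_mono) auto
      ultimately show ?thesis by linarith
    qed
  qed (use A in auto)
next
  fix A B :: real assume AB: "A > 0 \<and> B > 0"
  show "\<exists>c::real. c > 0 \<and>
        (\<forall>m n l P1 P2. line_config m n l P1 P2 \<and> n \<ge> 2 \<and>
           real m \<le> B * (real n powr (1/2) / ln (real n) powr (1/3)) \<and>
           real m \<ge> A * real n powr (3/10) \<longrightarrow>
           real (num_dist P1 P2) \<ge> c * (real n powr (3/8) * real m powr (3/4)))"
  proof (intro exI[of _ "min (1 / (72 * (2 * B) powr (1/4))) (A powr (5/4))"] conjI allI impI)
    fix m n l P1 P2
    assume "line_config m n l P1 P2 \<and> n \<ge> 2 \<and>
      real m \<le> B * (real n powr (1/2) / ln (real n) powr (1/3)) \<and> real m \<ge> A * real n powr (3/10)"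
    then have cfg: "line_config m n l P1 P2" and n: "n \<ge> 2"
      and mB: "real m \<le> B * (real n powr (1/2) / ln (real n) powr (1/3))"
      and mA: "real m \<ge> A * real n powr (3/10)" by auto
    have "A * real n powr (3/10) > 0" using AB n by simp
    then have m1: "m \<ge> 1" using mA by (cases m) auto
    let ?c = "min (1 / (72 * (2 * B) powr (1/4))) (A powr (5/4))" and ?d = "real (num_dist P1 P2)"
    let ?t = "real n powr (3/8) * real m powr (3/4)"
    show "?c * ?t \<le> ?d"
    proof (cases "m = 1")
      case False
      have "B * (real n powr (1/2) / ln (real n) powr (1/3)) = B * real n powr (1/2) * ln (real n) powr (-(1/3))"
        by (simp only: powr_minus_divide) simp
      also have "\<dots> \<le> B * real n powr (1/2) * 2"
        using AB ln_powr_le[OF n, of "1/3"] by (intro mult_left_mono) auto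
      finally have "real m \<le> (2 * B) * real n powr (1/2)" using mB by simp
      then have "real m powr (1/4) \<le> ((2 * B) * real n powr (1/2)) powr (1/4)"
        by (intro powr_mono2) auto
      also have "\<dots> = (2 * B) powr (1/4) * real n powr (1/8)"
        using AB by (simp add: powr_mult powr_powr)
      finally have m4: "real m powr (1/4) \<le> (2 * B) powr (1/4) * real n powr (1/8)" .
      \<comment> \<open>One factor \<open>m powr (1/4)\<close> is traded for
        \<open>n powr (1/8)\<close>, which turns the rest into the square root of
        \<open>m * n\<close>.\<close>
      have "?t = real n powr (3/8) * real m powr (1/2) * real m powr (1/4)"
        by (simp add: mult.assoc flip: powr_add)
      also have "\<dots> \<le> real n powr (3/8) * real m powr (1/2) * ((2 * B) powr (1/4) * real n powr (1/8))"
        using m4 by (intro mult_left_mono) auto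
      also have "\<dots> = (2 * B) powr (1/4) * (real m powr (1/2) * (real n powr (3/8) * real n powr (1/8)))"
        by simp
      also have "real n powr (3/8) * real n powr (1/8) = real n powr (1/2)" by (simp flip: powr_add)
      also have "(2 * B) powr (1/4) * (real m powr (1/2) * real n powr (1/2)) \<le> (2 * B) powr (1/4) * (72 * ?d)"
        using line_config_bound[OF cfg] False m1 n by (intro mult_left_mono) auto
      finally have "1 / (72 * (2 * B) powr (1/4)) * ?t \<le> ?d" using AB by (simp add: field_simps)
      moreover have "?c * ?t \<le> 1 / (72 * (2 * B) powr (1/4)) * ?t" by (intro mult_right_mono) auto
      ultimately show ?thesis by linarith
    next
      case True
      \<comment> \<open>For \<open>m = 1\<close> the exponent fits because
        \<open>3/8 = 3/10 * 5/4\<close>, so the lower bound on \<open>m\<close> makes the left side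
        at most 1.\<close>
      have "A powr (5/4) * ?t = (A * real n powr (3/10)) powr (5/4)"
        using True AB by (simp add: powr_mult powr_powr)
      also have "\<dots> \<le> 1 powr (5/4)" using mA True AB by (intro powr_mono2) auto
      also have "\<dots> \<le> ?d" using line_config_pos[OF cfg m1 n] by simp
      finally have "A powr (5/4) * ?t \<le> ?d" .
      moreover have "?c * ?t \<le> A powr (5/4) * ?t" by (intro mult_right_mono) auto
      ultimately show ?thesis by linarith
    qed
  qed (use AB in auto)
next
  fix B :: real assume "B > 0"
  show "\<exists>c::real. c > 0 \<and>
        (\<forall>m n l P1 P2. line_config m n l P1 P2 \<and> n \<ge> 2 \<and> m \<ge> 2 \<and>
           real m \<le> B * real n powr (3/10) \<longrightarrow>
           real (num_dist P1 P2) \<ge> c * (real n powr (1/2) * real m powr (1/3)))"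
  proof (intro exI[of _ "1/72"] conjI allI impI)
    fix m n l P1 P2
    assume "line_config m n l P1 P2 \<and> n \<ge> 2 \<and> m \<ge> 2 \<and> real m \<le> B * real n powr (3/10)"
    then have cfg: "line_config m n l P1 P2" and n: "n \<ge> 2" and m: "m \<ge> 2" by auto
    have "real n powr (1/2) * real m powr (1/3) \<le> real n powr (1/2) * real m powr (1/2)"
      using m by (intro mult_left_mono powr_mono) auto
    also have "\<dots> \<le> 72 * real (num_dist P1 P2)"
      using line_config_bound[OF cfg m n] by (simp add: mult.commute)
    finally show "1/72 * (real n powr (1/2) * real m powr (1/3)) \<le> real (num_dist P1 P2)" by simp
  qed simp
qed

end
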